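(* Every opened modular numerical semigroup is almost symmetric.
   Context: A numerical semigroup is a subset $H\subseteq\mathbb{N}=\{0,1,2,\dots\}$ containing $0$, closed under addition, with $\mathbb{N}\setminus H$ finite. For an interval $I$ of positive real numbers, $\langle I\rangle$ denotes the submonoid of $(\mathbb{R}_{\ge 0},+)$ generated by $I$, and $\mathrm{S}(I)=\langle I\rangle\cap\mathbb{N}$. A half-line is a numerical semigroup of the form $\{0,m,m+1,m+2,\dots\}$ with $m\ge 1$ an integer. A numerical semigroup $H$ is opened modular if it is either a half-line or $H=\mathrm{S}\left(\left]\frac{b}{a},\frac{b}{a-1}\right[\right)$ (open interval) for some integers $a,b$ with $2\le a\le b$. Let $\mathrm{g}(H)=|\mathbb{N}\setminus H|$, let $\mathrm{F}(H)$ be the largest integer not in $H$ (so $\mathrm{F}(\mathbb{N})=-1$), let $\mathrm{PF}(H)=\{x\in\mathbb{Z}\setminus H \mid x+h\in H\text{ for all }h\in H,\ h\neq 0\}$ and $\mathrm{t}(H)=|\mathrm{PF}(H)|$. $H$ is almost symmetric if $2\mathrm{g}(H)=\mathrm{F}(H)+\mathrm{t}(H)$. *)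

theory Defs
  imports Complex_Main
begin

definition numerical_semigroup :: "nat set \<Rightarrow> bool" where
  "numerical_semigroup H \<longleftrightarrow>
     0 \<in> H \<and> (\<forall>x\<in>H. \<forall>y\<in>H. x + y \<in> H) \<and> finite (UNIV - H)"

inductive_set generated_submonoid :: "real set \<Rightarrow> real set" for I :: "real set" where
  zero: "0 \<in> generated_submonoid I"
| incl: "x \<in> I \<Longrightarrow> x \<in> generated_submonoid I"
| add: "x \<in> generated_submonoid I \<Longrightarrow> y \<in> generated_submonoid I \<Longrightarrow> x + y \<in> generated_submonoid I"

definition S_of :: "real set \<Rightarrow> nat set" where
  "S_of I = {n. real n \<in> generated_submonoid I}"

definition half_line :: "nat set \<Rightarrow> bool" where
  "half_line H \<longleftrightarrow> numerical_semigroup H \<and> (\<exists>m\<ge>1. H = {0} \<union> {m..})"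

definition opened_modular :: "nat set \<Rightarrow> bool" where
  "opened_modular H \<longleftrightarrow> numerical_semigroup H \<and>
     (half_line H \<or>
      (\<exists>a b :: int. 2 \<le> a \<and> a \<le> b \<and>
         H = S_of {real_of_int b / real_of_int a <..< real_of_int b / (real_of_int a - 1)}))"

definition genus :: "nat set \<Rightarrow> nat" where
  "genus H = card (UNIV - H)"

text \<open>The Frobenius number and the pseudo-Frobenius numbers range over the integers
  (they are \<open>-1\<close> and \<open>{-1}\<close> when \<open>H = UNIV\<close>), hence the embedding \<open>int ` H\<close>.\<close>

definition Frobenius :: "nat set \<Rightarrow> int" where
  "Frobenius H = (GREATEST x. x \<notin> int ` H)"

definition pseudo_Frobenius :: "nat set \<Rightarrow> int set" where
  "pseudo_Frobenius H = {x. x \<notin> int ` H \<and> (\<forall>h\<in>H. h \<noteq> 0 \<longrightarrow> x + int h \<in> int ` H)}"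

definition semigroup_type :: "nat set \<Rightarrow> nat" where
  "semigroup_type H = card (pseudo_Frobenius H)"

definition almost_symmetric :: "nat set \<Rightarrow> bool" where
  "almost_symmetric H \<longleftrightarrow> 2 * int (genus H) = Frobenius H + int (semigroup_type H)"

end

theory Submission
  imports Defs
begin

text \<open>
  Write \<open>L\<close> for the set of gaps \<open>x\<close> such that \<open>F - x\<close> is a gap too, where \<open>F\<close> is the Frobenius
  number. Since \<open>x \<mapsto> F - x\<close> sends elements below \<open>F\<close> to gaps outside \<open>L\<close>, one has
  \<open>2 g = F + 1 + |L|\<close>, while the pseudo-Frobenius numbers are contained in \<open>L \<union> {F}\<close>; hence
  the semigroup is almost symmetric as soon as every element of \<open>L\<close> is pseudo-Frobenius.

  A positive \<open>n\<close> lies in \<open>S(]b/a, b/(a-1)[)\<close> iff \<open>s n < n\<close>, where \<open>s n\<close> is the representative of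
  \<open>a n\<close> modulo \<open>b\<close> in \<open>{1..b}\<close>. So \<open>F = b\<close>, and \<open>s (b - n) = b - s n\<close> unless \<open>s n = b\<close>, so
  \<open>n \<in> L\<close> forces \<open>s n = n\<close> or \<open>s n = b\<close>. As \<open>s\<close> is subadditive, and \<open>s (n + h) = s h\<close> when
  \<open>s n = b\<close>, adding a nonzero element \<open>h\<close> of the semigroup to such an \<open>n\<close> gives \<open>s (n + h) < n + h\<close>.
\<close>

section \<open>A criterion for almost symmetry\<close>

lemma almost_symmetric_UNIV: "almost_symmetric UNIV"
proof -
  have range: "x \<in> range int \<longleftrightarrow> 0 \<le> x" for x :: int
    by (metis nat_0_le of_nat_0_le_iff rangeE rangeI)
  have F: "Frobenius UNIV = -1"
    unfolding Frobenius_def by (rule Greatest_equality) (auto simp: range)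
  have "x = -1" if "x < 0" and "\<forall>h>0. 0 \<le> x + int h" for x
    using that(1) spec[OF that(2), of 1] by simp
  then have "pseudo_Frobenius UNIV = {-1}"
    unfolding pseudo_Frobenius_def by (auto simp: range)
  then show ?thesis
    by (simp add: almost_symmetric_def F genus_def semigroup_type_def)
qed

lemma almost_symmetricI:
  fixes H :: "nat set" and F :: nat
  assumes H: "numerical_semigroup H"
    and F: "F \<notin> H" "\<And>n. F < n \<Longrightarrow> n \<in> H"
    and PF: "\<And>x h. \<lbrakk>x \<le> F; x \<notin> H; F - x \<notin> H; h \<in> H; h \<noteq> 0\<rbrakk> \<Longrightarrow> x + h \<in> H"
  shows "almost_symmetric H"
proof -
  have zero: "0 \<in> H" and add: "\<And>x y. x \<in> H \<Longrightarrow> y \<in> H \<Longrightarrow> x + y \<in> H"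
    using H by (auto simp: numerical_semigroup_def)
  define L where "L = {x. x \<le> F \<and> x \<notin> H \<and> F - x \<notin> H}"
  have finL: "finite L" by (simp add: L_def)
  have FL: "F \<notin> L" by (simp add: L_def zero)
  have Frob: "Frobenius H = int F"
    unfolding Frobenius_def
  proof (rule Greatest_equality)
    fix y assume "y \<notin> int ` H"
    then show "y \<le> int F"
      using F(2)[of "nat y"] by (metis image_eqI le_nat_iff linorder_not_le nat_0_le nat_int
          of_nat_0_le_iff order_less_imp_le order_trans zless_nat_eq_int_zless)
  qed (use F in auto)
  have "pseudo_Frobenius H = int ` insert F L"
  proof (intro equalityI subsetI)
    fix x assume x: "x \<in> pseudo_Frobenius H"
    have shift: "x + int h \<in> int ` H" if "h \<in> H" "h \<noteq> 0" for h
      using x that by (simp add: pseudo_Frobenius_def)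
    have "0 \<le> x"
    proof (rule ccontr)
      assume neg: "\<not> 0 \<le> x"
      \<comment> \<open>For negative \<open>x\<close> the shift \<open>F - x\<close> exceeds
        \<open>F\<close>, so it is a nonzero element of \<open>H\<close>, yet it carries
        \<open>x\<close> to the gap \<open>F\<close>.\<close>
      then have "x + int (F + nat (- x)) \<in> int ` H"
        by (intro shift F(2)) auto
      with neg F(1) show False by auto
    qed
    then obtain n where n: "x = int n" by (metis nat_0_le)
    with x have nH: "n \<notin> H" by (auto simp: pseudo_Frobenius_def)
    then have "n \<le> F" using F(2) by (meson not_le)
    moreover have "F - n \<notin> H" if "n \<noteq> F"
    proof
      assume "F - n \<in> H"
      then have "x + int (F - n) \<in> int ` H"
        using that \<open>n \<le> F\<close> by (intro shift) auto
      with n \<open>n \<le> F\<close> F(1) show False by auto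
    qed
    ultimately show "x \<in> int ` insert F L"
      using n nH by (auto simp: L_def)
  next
    fix x assume "x \<in> int ` insert F L"
    then obtain n where n: "x = int n" "n \<in> insert F L" by blast
    have "n + h \<in> H" if "h \<in> H" "h \<noteq> 0" for h
      using n(2) that F(2)[of "F + h"] PF[of n h] by (auto simp: L_def)
    then show "x \<in> pseudo_Frobenius H"
      using n F(1) by (auto simp: pseudo_Frobenius_def L_def simp flip: of_nat_add)
  qed
  then have type: "semigroup_type H = Suc (card L)"
    using finL FL by (simp add: semigroup_type_def card_image[OF inj_on_of_nat] del: image_insert)
  define E where "E = H \<inter> {..F}"
  have finE: "finite E" by (simp add: E_def)
  \<comment> \<open>A gap outside \<open>L\<close> reflects to an element of \<open>H\<close>;
    conversely, the reflection of an element is a gap because \<open>F\<close> is not a sum of two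
    elements.\<close>
  have gaps: "UNIV - H = L \<union> (\<lambda>x. F - x) ` E"
  proof (intro equalityI subsetI)
    fix x assume "x \<in> UNIV - H"
    then have "x \<notin> H" "x \<le> F" using F(2) by (auto simp: not_le[symmetric])
    then show "x \<in> L \<union> (\<lambda>x. F - x) ` E"
      by (cases "F - x \<in> H") (auto simp: L_def E_def intro!: image_eqI[of _ _ "F - x"])
  next
    fix x assume "x \<in> L \<union> (\<lambda>x. F - x) ` E"
    then show "x \<in> UNIV - H"
      using F(1) add[of x "F - x"] add by (auto simp: L_def E_def) (metis le_add_diff_inverse)
  qed
  have "L \<inter> (\<lambda>x. F - x) ` E = {}" by (auto simp: L_def E_def)
  moreover have "inj_on (\<lambda>x. F - x) E" by (auto simp: inj_on_def E_def)
  ultimately have g1: "genus H = card L + card E"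
    using finL finE by (simp add: genus_def gaps card_Un_disjoint card_image)
  have fin: "finite (UNIV - H)" using H by (simp add: numerical_semigroup_def)
  have "{..F} = E \<union> (UNIV - H)" using F(2) by (auto simp: E_def not_le[symmetric])
  then have "card {..F} = card (E \<union> (UNIV - H))" by simp
  also have "\<dots> = card E + card (UNIV - H)"
    using finE fin by (intro card_Un_disjoint) (auto simp: E_def)
  finally have g2: "Suc F = card E + genus H" by (simp add: genus_def)
  \<comment> \<open>Adding \<open>g1\<close> and \<open>g2\<close> cancels \<open>card E\<close>;
    the 1 in \<open>Suc F\<close> is the contribution of \<open>F\<close> itself to the
    type.\<close>
  show ?thesis
    using g1 g2 by (simp add: almost_symmetric_def Frob type)
qed

section \<open>Monoids generated by open intervals\<close>

lemma generated_submonoid_of_nat_mult: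
  assumes "x \<in> I"
  shows "real k * x \<in> generated_submonoid I"
  by (induction k)
    (auto simp: algebra_simps intro: generated_submonoid.intros assms)

text \<open>A sum of \<open>k\<close> generators lies strictly between \<open>k * c\<close> and
  \<open>k * d\<close>; conversely such an \<open>x\<close> is the sum of \<open>k\<close> copies of
  \<open>x / k\<close>.\<close>

lemma generated_submonoid_greaterThanLessThan:
  "x \<in> generated_submonoid {c<..<d} \<longleftrightarrow>
    x = 0 \<or> (\<exists>k::nat>0. real k * c < x \<and> x < real k * d)"
proof
  assume "x \<in> generated_submonoid {c<..<d}"
  then show "x = 0 \<or> (\<exists>k::nat>0. real k * c < x \<and> x < real k * d)"
  proof induction
    case zero
    show ?case by simp
  next
    case (incl x)
    then show ?case by (intro disjI2 exI[of _ 1]) auto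
  next
    case (add x y)
    show ?case
    proof (cases "x = 0 \<or> y = 0")
      case True
      with add.IH show ?thesis by auto
    next
      case False
      with add.IH obtain k l :: nat where "k > 0" "real k * c < x" "x < real k * d"
        "real l * c < y" "y < real l * d" by auto
      then show ?thesis
        by (intro disjI2 exI[of _ "k + l"]) (auto simp: algebra_simps)
    qed
  qed
next
  assume "x = 0 \<or> (\<exists>k::nat>0. real k * c < x \<and> x < real k * d)"
  then show "x \<in> generated_submonoid {c<..<d}"
  proof
    assume "\<exists>k::nat>0. real k * c < x \<and> x < real k * d"
    then obtain k :: nat where k: "k > 0" "real k * c < x" "x < real k * d" by blast
    then have "x / real k \<in> {c<..<d}" by (simp add: field_simps)
    from generated_submonoid_of_nat_mult[OF this, of k] k(1) show ?thesis by simp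
  qed (simp add: generated_submonoid.zero)
qed

section \<open>Residues in \<open>{1..b}\<close>\<close>

definition pos_residue :: "int \<Rightarrow> int \<Rightarrow> int" where
  "pos_residue b m = (m - 1) mod b + 1"

lemma pos_residue_bounds:
  assumes "b > 0"
  shows "1 \<le> pos_residue b m" "pos_residue b m \<le> b"
  using assms by (auto simp: pos_residue_def add1_zle_eq)

lemma pos_residue_eqI:
  assumes "1 \<le> r" "r \<le> b" "m = b * q + r"
  shows "pos_residue b m = r"
proof -
  have "m - 1 = (r - 1) + b * q" using assms by simp
  then have "(m - 1) mod b = (r - 1) mod b" by (metis mod_mult_self2)
  then show ?thesis using assms by (simp add: pos_residue_def)
qed

lemma pos_residue_decomp: "m = b * ((m - 1) div b) + pos_residue b m"
  by (simp add: pos_residue_def)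

text \<open>For \<open>b > 0\<close> the residue is the least positive integer congruent to
  \<open>m\<close> modulo \<open>b\<close>. This minimality also yields subadditivity.\<close>

lemma pos_residue_le:
  assumes "b > 0" "b * q < m"
  shows "pos_residue b m \<le> m - b * q"
proof -
  have "(m - 1) mod b = (m - 1 - b * q) mod b"
    by (metis mod_mult_self2 diff_add_cancel)
  also have "\<dots> \<le> m - 1 - b * q"
    using assms by (intro zmod_le_nonneg_dividend) auto
  finally show ?thesis by (simp add: pos_residue_def)
qed

lemma pos_residue_add_le:
  assumes "b > 0"
  shows "pos_residue b (m + n) \<le> pos_residue b m + pos_residue b n"
proof -
  have "pos_residue b (m + n) \<le> m + n - b * ((m - 1) div b + (n - 1) div b)"
    using pos_residue_bounds(1)[OF assms, of m] pos_residue_bounds(1)[OF assms, of n]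
      pos_residue_decomp[of m b] pos_residue_decomp[of n b] assms
    by (intro pos_residue_le) (auto simp: algebra_simps)
  then show ?thesis
    using pos_residue_decomp[of m b] pos_residue_decomp[of n b] by (simp add: algebra_simps)
qed

lemma pos_residue_add_full:
  assumes "b > 0" "pos_residue b m = b"
  shows "pos_residue b (m + n) = pos_residue b n"
  using pos_residue_bounds[OF assms(1), of n] pos_residue_decomp[of m b]
    pos_residue_decomp[of n b] assms(2)
  by (intro pos_residue_eqI[where q = "(m - 1) div b + 1 + (n - 1) div b"])
    (auto simp: algebra_simps)

text \<open>Excluding the residue \<open>b\<close>, that is, multiples of \<open>b\<close>, keeps
  the reflected value at least 1 and hence a valid representative.\<close>

lemma pos_residue_reflect:
  assumes "b > 0" "pos_residue b m \<noteq> b"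
  shows "pos_residue b (a * b - m) = b - pos_residue b m"
  using pos_residue_bounds[OF assms(1), of m] pos_residue_decomp[of m b] assms(2)
  by (intro pos_residue_eqI[where q = "a - 1 - (m - 1) div b"]) (auto simp: algebra_simps)

text \<open>Clearing denominators, \<open>n\<close> needs a \<open>k\<close> with
  \<open>0 < a * n - b * k < n\<close>; the least positive value of that difference is the residue
  of \<open>a * n\<close>.\<close>

lemma mem_S_of_iff_pos_residue:
  fixes a b :: int
  assumes "2 \<le> a" "0 < b"
  shows "n \<in> S_of {real_of_int b / real_of_int a <..< real_of_int b / (real_of_int a - 1)}
    \<longleftrightarrow> n = 0 \<or> pos_residue b (a * int n) < int n" (is "n \<in> ?H \<longleftrightarrow> _")
proof -
  have "real k * (real_of_int b / real_of_int a) < real n \<longleftrightarrow> b * int k < a * int n" for k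
  proof -
    have "real k * (real_of_int b / real_of_int a) < real n
        \<longleftrightarrow> real_of_int (b * int k) < real_of_int (a * int n)"
      using assms by (simp add: field_simps)
    then show ?thesis by (simp only: of_int_less_iff)
  qed
  moreover have "real n < real k * (real_of_int b / (real_of_int a - 1))
    \<longleftrightarrow> (a - 1) * int n < b * int k" for k
  proof -
    have "real n < real k * (real_of_int b / (real_of_int a - 1))
        \<longleftrightarrow> real_of_int ((a - 1) * int n) < real_of_int (b * int k)"
      using assms by (simp add: field_simps)
    then show ?thesis by (simp only: of_int_less_iff)
  qed
  ultimately have mem: "n \<in> ?H \<longleftrightarrow>
      n = 0 \<or> (\<exists>k::nat>0. b * int k < a * int n \<and> (a - 1) * int n < b * int k)"
    by (simp add: S_of_def generated_submonoid_greaterThanLessThan)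
  have "pos_residue b (a * int n) < int n"
    if "b * int k < a * int n" "(a - 1) * int n < b * int k" for k
    using pos_residue_le[OF assms(2) that(1)] that(2) by (simp add: algebra_simps)
  moreover have "\<exists>k::nat>0. b * int k < a * int n \<and> (a - 1) * int n < b * int k"
    if less: "pos_residue b (a * int n) < int n"
  proof -
    define q where "q = (a * int n - 1) div b"
    have dec: "a * int n = b * q + pos_residue b (a * int n)"
      unfolding q_def by (rule pos_residue_decomp)
    have "1 \<le> pos_residue b (a * int n)" by (rule pos_residue_bounds) fact
    with dec less have q: "b * q < a * int n" "(a - 1) * int n < b * q"
      by (simp_all add: algebra_simps)
    \<comment> \<open>This makes the quotient \<open>q\<close> positive, so it can serve as the
      number \<open>k\<close> of summands.\<close>
    have "0 \<le> (a - 1) * int n" using assms by simp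
    with q(2) have "0 < b * q" by linarith
    then have "0 < q" using assms by (simp add: zero_less_mult_iff)
    with q show ?thesis by (intro exI[of _ "nat q"]) auto
  qed
  ultimately show ?thesis unfolding mem by blast
qed

theorem corollary4p13:
  fixes H :: "nat set"
  assumes "numerical_semigroup H" and "opened_modular H"
  shows "almost_symmetric H"
proof -
  consider m where "m \<ge> 1" "H = {0} \<union> {m..}"
    | a b :: int where "2 \<le> a" "a \<le> b"
      "H = S_of {real_of_int b / real_of_int a <..< real_of_int b / (real_of_int a - 1)}"
    using assms(2) unfolding opened_modular_def half_line_def by blast
  then show ?thesis
  proof cases
    case 1
    show ?thesis
    \<comment> \<open>For \<open>m = 1\<close> the Frobenius number is -1, outside the natural
      numbers that the criterion allows.\<close>
    proof (cases "m = 1")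
      case True
      with 1 have "H = UNIV" by auto
      then show ?thesis by (simp add: almost_symmetric_UNIV)
    next
      case False
      with 1 show ?thesis
        by (intro almost_symmetricI[where F = "m - 1"] assms(1)) auto
    qed
  next
    case 2
    define s where "s n = pos_residue b (a * int n)" for n
    have b: "b > 0" using 2 by simp
    have mem: "n \<in> H \<longleftrightarrow> n = 0 \<or> s n < int n" for n
      unfolding 2(3) s_def using 2 b by (intro mem_S_of_iff_pos_residue) auto
    show ?thesis
    proof (rule almost_symmetricI[where F = "nat b"])
      \<comment> \<open>As a multiple of \<open>b\<close>, \<open>a * b\<close> has residue
        \<open>b\<close> rather than 0, hence the quotient \<open>a - 1\<close>; this makes
        \<open>b\<close> a gap.\<close>
      have "s (nat b) = b"
        unfolding s_def using b
        by (intro pos_residue_eqI[where q = "a - 1"]) (auto simp: algebra_simps)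
      with b show "nat b \<notin> H" by (simp add: mem)
    next
      fix n assume "nat b < n"
      then show "n \<in> H"
        using pos_residue_bounds(2)[OF b, of "a * int n"] by (simp add: mem s_def)
    next
      fix x h
      assume x: "x \<le> nat b" "x \<notin> H" "nat b - x \<notin> H" and h: "h \<in> H" "h \<noteq> 0"
      have sh: "s h < int h" using h by (simp add: mem)
      have sx: "int x \<le> s x" using x(2) by (simp add: mem)
      show "x + h \<in> H"
      proof (cases "s x = b")
        case True
        then have "s (x + h) = s h"
          using pos_residue_add_full[OF b, of "a * int x"] by (simp add: s_def algebra_simps)
        with sh show ?thesis by (simp add: mem)
      next
        case False
        have int_diff: "int (nat b - x) = b - int x" using x(1) b by simp
        have "s (nat b - x) = b - s x"
          using pos_residue_reflect[OF b, of "a * int x" a] False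
          by (simp add: s_def int_diff algebra_simps)
        \<comment> \<open>Since \<open>b - x\<close> is a gap, \<open>b - x \<le> b - s x\<close>,
          which is the reverse of \<open>sx\<close>.\<close>
        moreover have "int (nat b - x) \<le> s (nat b - x)"
          using x(3) unfolding mem by linarith
        ultimately have "s x = int x" using sx int_diff by linarith
        moreover have "s (x + h) \<le> s x + s h"
          using pos_residue_add_le[OF b, of "a * int x" "a * int h"]
          by (simp add: s_def algebra_simps)
        ultimately show ?thesis using sh by (simp add: mem)
      qed
    qed (rule assms(1))
  qed
qed

end
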